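(* For all integers $n,m\ge 0$ the following identities hold (all sums are over integers $i\ge 0$; only terms with $m\le i\le n$ can be nonzero). (a) Lah numbers convert between Stirling and tanh numbers: $$\Theta(n,m)=\sum_i \overline{L}(i,m)\,S(n,i),\qquad S(n,m)=\sum_i \overline{l}(i,m)\,\Theta(n,i),$$ $$\theta(n,m)=\sum_i \overline{l}(n,i)\,s(i,m),\qquad s(n,m)=\sum_i \overline{L}(n,i)\,\theta(i,m).$$ (b) Stirling numbers convert between Lah and tanh numbers: $$\overline{L}(n,m)=\sum_i s(n,i)\,\Theta(i,m),\qquad \Theta(n,m)=\sum_i S(n,i)\,\overline{L}(i,m),$$ $$\overline{l}(n,m)=\sum_i S(i,m)\,\theta(n,i),\qquad \theta(n,m)=\sum_i s(i,m)\,\overline{l}(n,i).$$ (c) Tanh numbers convert between Lah and Stirling numbers: $$\overline{l}(n,m)=\sum_i \theta(n,i)\,S(i,m),\qquad S(n,m)=\sum_i \Theta(n,i)\,\overline{l}(i,m),$$ $$\overline{L}(n,m)=\sum_i \Theta(i,m)\,s(n,i),\qquad s(n,m)=\sum_i \theta(i,m)\,\overline{L}(n,i).$$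
   Context: For integers $n,m\ge 0$: Scaled Stirling numbers: $s(n,m)=(-2)^{n-m}c(n,m)$, where $c(n,m)$ is the unsigned Stirling number of the first kind, and $S(n,m)=2^{n-m}\cdot$(Stirling number of the second kind, i.e. the number of partitions of an $n$-set into $m$ nonempty blocks). Both are $0$ for $m>n$. Tanh numbers: let $t(n,m)$ and $T(n,m)$ be defined by $\sum_n t(n,m)\frac{v^n}{n!}=\frac{1}{m!}\arctan^m v$ and $\sum_n T(n,m)\frac{v^n}{n!}=\frac1{m!}\tan^m v$. Put $\theta(n,m)=(-1)^{(n-m)/2}t(n,m)$ and $\Theta(n,m)=(-1)^{(n-m)/2}T(n,m)$ when $n-m$ is even, and $\theta(n,m)=\Theta(n,m)=0$ when $n-m$ is odd. Equivalently, $\sum_n\theta(n,m)\frac{u^n}{n!}=\frac1{m!}(\operatorname{artanh} u)^m$ and $\sum_n\Theta(n,m)\frac{u^n}{n!}=\frac1{m!}\tanh^m u$. Scaled Lah numbers: $\overline{l}(n,m)=\frac{n!}{m!}\binom{n-1}{m-1}$ for $n,m\ge 1$, $\overline{l}(n,0)=0$ for $n\ge1$, $\overline{l}(0,m)=1$ if $m=0$ and $0$ otherwise; $\overline{L}(n,m)=(-1)^{n-m}\overline{l}(n,m)$. Equivalently, $\sum_n\overline{l}(n,m)\frac{u^n}{n!}=\frac1{m!}\left(\frac{u}{1-u}\right)^m$ and $\sum_n\overline{L}(n,m)\frac{u^n}{n!}=\frac1{m!}\left(\frac{u}{1+u}\right)^m$. *)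

theory Defs
  imports "HOL-Analysis.Analysis" "HOL-Combinatorics.Stirling"
begin

text \<open>Integer exponents (\<open>powi\<close>) are used so that \<open>n - m\<close> is the true difference, also for \<open>m > n\<close>.\<close>

definition stir_s :: "nat \<Rightarrow> nat \<Rightarrow> real" where
  "stir_s n m = (-2) powi (int n - int m) * real (stirling n m)"

definition stir_S :: "nat \<Rightarrow> nat \<Rightarrow> real" where
  "stir_S n m = 2 powi (int n - int m) * real (Stirling n m)"

text \<open>The library has the tangent series \<^const>\<open>fps_tan\<close> but no formal arctangent.\<close>

definition fps_arctan :: "real fps" where
  "fps_arctan = Abs_fps (\<lambda>n. if odd n then (-1) ^ (n div 2) / real n else 0)"

lemma has_fps_expansion_arctan: "arctan has_fps_expansion fps_arctan"
proof (rule has_fps_expansionI)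
  have "eventually (\<lambda>x::real. x \<in> ball 0 1) (nhds 0)"
    by (intro eventually_nhds_in_open) auto
  then show "eventually (\<lambda>x. (\<lambda>n. fps_nth fps_arctan n * x ^ n) sums arctan x) (nhds 0)"
  proof eventually_elim
    case (elim x)
    then have x: "\<bar>x\<bar> \<le> 1" by simp
    have "(\<lambda>k. (-1) ^ k * (1 / real (k * 2 + 1) * x ^ (k * 2 + 1))) sums arctan x"
      using summable_sums[OF summable_arctan_series[OF x]] arctan_series[OF x] by simp
    then have "(\<lambda>k. (\<lambda>n. fps_nth fps_arctan n * x ^ n) (2 * k + 1)) sums arctan x"
      by (simp add: fps_arctan_def mult_ac)
    then show ?case
      by (subst (asm) sums_mono_reindex)
         (auto simp: strict_mono_def fps_arctan_def elim!: oddE)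
  qed
qed

text \<open>The arctangent and tangent numbers are read off from their exponential generating
  functions \<open>arctan\<^sup>m v / m!\<close> and \<open>tan\<^sup>m v / m!\<close>.\<close>

definition arctan_t :: "nat \<Rightarrow> nat \<Rightarrow> real" where
  "arctan_t n m = fact n * fps_nth (fps_const (1 / fact m) * fps_arctan ^ m) n"

definition tan_T :: "nat \<Rightarrow> nat \<Rightarrow> real" where
  "tan_T n m = fact n * fps_nth (fps_const (1 / fact m) * fps_tan 1 ^ m) n"

definition tanh_theta :: "nat \<Rightarrow> nat \<Rightarrow> real" where
  "tanh_theta n m =
     (if even (int n - int m) then (-1) powi ((int n - int m) div 2) * arctan_t n m else 0)"

definition tanh_Theta :: "nat \<Rightarrow> nat \<Rightarrow> real" where
  "tanh_Theta n m =
     (if even (int n - int m) then (-1) powi ((int n - int m) div 2) * tan_T n m else 0)"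

definition lah_l :: "nat \<Rightarrow> nat \<Rightarrow> real" where
  "lah_l n m =
     (if n = 0 \<or> m = 0 then (if n = m then 1 else 0)
      else fact n / fact m * real ((n - 1) choose (m - 1)))"

definition lah_L :: "nat \<Rightarrow> nat \<Rightarrow> real" where
  "lah_L n m = (-1) powi (int n - int m) * lah_l n m"

text \<open>All six arrays are lower triangular, so a sum over all \<open>i \<ge> 0\<close> of products with outer indices
  \<open>n\<close>, \<open>m\<close> reduces to the sum over \<open>i \<le> n\<close>.\<close>

lemma lower_triangular:
  assumes "n < m"
  shows "stir_s n m = 0" "stir_S n m = 0" "tanh_theta n m = 0" "tanh_Theta n m = 0"
        "lah_l n m = 0" "lah_L n m = 0"
proof -
  have "fps_nth fps_arctan 0 = 0" "fps_nth (fps_tan (1::real)) 0 = 0"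
    by (simp_all add: fps_arctan_def fps_tan_def)
  then have "arctan_t n m = 0" "tan_T n m = 0"
    using assms startsby_zero_power_prefix[of fps_arctan m] startsby_zero_power_prefix[of "fps_tan 1 :: real fps" m]
    by (simp_all add: arctan_t_def tan_T_def)
  then show "tanh_theta n m = 0" "tanh_Theta n m = 0"
    by (simp_all add: tanh_theta_def tanh_Theta_def)
  show "stir_s n m = 0" "stir_S n m = 0" "lah_l n m = 0" "lah_L n m = 0"
    using assms by (auto simp: stir_s_def stir_S_def lah_l_def lah_L_def)
qed

end

theory Submission
  imports Defs
begin

text \<open>
  Each of the six arrays is the array of exponential coefficients of the powers
  \<open>f\<^sup>m / m!\<close> of one formal power series \<open>f\<close> without constant term. For such arrays the matrix
  product is composition of series (\<open>sum_egf_array\<close>), so all identities follow from relations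
  between six series. Write \<open>S = (e\<^sup>2\<^sup>u - 1) / 2\<close>, let \<open>s\<close> be its compositional inverse
  \<open>ln (1 + 2 u) / 2\<close>, and put \<open>l = u / (1 - u)\<close>, \<open>L = u / (1 + u)\<close>. Then \<open>tanh = L \<circ> S\<close>
  and \<open>artanh = s \<circ> l\<close>; together with \<open>S \<circ> s = u\<close> and \<open>l \<circ> L = u\<close> this gives
  \<open>tanh \<circ> s = L\<close>, \<open>l \<circ> tanh = S\<close>, \<open>artanh \<circ> L = s\<close> and \<open>S \<circ> artanh = l\<close>. Up to the
  order of the factors, the twelve identities are these six relations, each taken twice.

  It remains to recognise the six series. A differential equation
  \<open>f' = 1 + a f + b f\<^sup>2\<close> or \<open>(1 + a u + b u\<^sup>2) f' = 1\<close> with constant coefficients is the same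
  as a recurrence for the array of \<open>f\<close> (\<open>egf_array_riccati\<close>, \<open>egf_array_rational_deriv\<close>), and
  the recurrence determines the array. For the Stirling numbers these are the defining recurrences.
  For \<open>tan\<close> and \<open>arctan\<close>, the alternating signs turn \<open>b = 1\<close> into \<open>b = -1\<close>, that is, into the
  equations of \<open>tanh\<close> and \<open>artanh\<close>. The Lah numbers are handled by Pascal's rule.
\<close>

section \<open>Arrays of exponential coefficients of powers\<close>

definition egf_array :: "'a::field_char_0 fps \<Rightarrow> nat \<Rightarrow> nat \<Rightarrow> 'a" where
  "egf_array f n m = fact n / fact m * fps_nth (f ^ m) n"

lemma egf_array_0_left: "fps_nth f 0 = 0 \<Longrightarrow> egf_array f 0 m = (if m = 0 then 1 else 0)"
  by (simp add: egf_array_def)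

lemma egf_array_Suc_0: "egf_array f (Suc n) 0 = 0"
  by (simp add: egf_array_def)

text \<open>Since \<open>(f \<circ> g)\<^sup>m = f\<^sup>m \<circ> g\<close>, expanding \<open>f\<^sup>m\<close> in powers of \<open>g\<close> yields a matrix product;
  the factors \<open>i!\<close> cancel.\<close>

lemma sum_egf_array:
  assumes "fps_nth g 0 = 0"
  shows "(\<Sum>i\<le>n. egf_array g n i * egf_array f i m) = egf_array (f oo g) n m"
proof -
  have "egf_array (f oo g) n m = fact n / fact m * (\<Sum>i\<le>n. fps_nth (f ^ m) i * fps_nth (g ^ i) n)"
    using fps_compose_power[OF assms, of f m]
    by (simp add: egf_array_def fps_compose_nth atLeast0AtMost)
  also have "\<dots> = (\<Sum>i\<le>n. egf_array g n i * egf_array f i m)"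
    by (simp add: egf_array_def sum_distrib_left field_simps)
  finally show ?thesis by simp
qed

lemma egf_array_Suc_Suc:
  "egf_array f (Suc n) (Suc m) = fact n / fact m * fps_nth (fps_deriv f * f ^ m) n"
proof -
  have "of_nat (Suc n) * fps_nth (f ^ Suc m) (Suc n) = fps_nth (fps_deriv (f ^ Suc m)) n"
    by (simp del: power_Suc)
  also have "fps_deriv (f ^ Suc m) = fps_const (of_nat (Suc m)) * (fps_deriv f * f ^ m)"
    by (subst fps_deriv_power) (simp add: algebra_simps)
  also have "fps_nth \<dots> n = of_nat (Suc m) * fps_nth (fps_deriv f * f ^ m) n"
    by (rule fps_mult_left_const_nth)
  finally have *: "of_nat (Suc n) * fps_nth (f ^ Suc m) (Suc n)
      = of_nat (Suc m) * fps_nth (fps_deriv f * f ^ m) n" .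
  have "egf_array f (Suc n) (Suc m)
      = fact n / (of_nat (Suc m) * fact m) * (of_nat (Suc n) * fps_nth (f ^ Suc m) (Suc n))"
    by (simp add: egf_array_def del: of_nat_Suc power_Suc)
  also have "\<dots> = fact n / fact m * fps_nth (fps_deriv f * f ^ m) n"
    unfolding * by (simp add: field_simps del: of_nat_Suc)
  finally show ?thesis .
qed

text \<open>Substituting the equation into \<open>(f\<^sup>m\<^sup>+\<^sup>1 / (m+1)!)' = f' f\<^sup>m / m!\<close> leaves powers of \<open>f\<close> with
  constant coefficients, so that one row is expressed by neighbouring columns of the previous row.\<close>

lemma egf_array_riccati:
  assumes "fps_deriv f = 1 + fps_const a * f + fps_const b * f ^ 2"
  shows "egf_array f (Suc n) (Suc m) = egf_array f n m + a * of_nat (Suc m) * egf_array f n (Suc m)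
           + b * of_nat (Suc m) * of_nat (Suc (Suc m)) * egf_array f n (Suc (Suc m))"
proof -
  have "fps_deriv f * f ^ m = f ^ m + fps_const a * f ^ Suc m + fps_const b * f ^ Suc (Suc m)"
    unfolding assms by (simp add: algebra_simps power2_eq_square)
  then show ?thesis
    unfolding egf_array_Suc_Suc
    by (simp add: egf_array_def field_simps del: of_nat_Suc power_Suc)
qed

text \<open>Here the coefficients of the equation are polynomials in the variable; multiplying by the
  variable shifts coefficients, so that the recurrence reaches back to earlier rows. For \<open>n = 0\<close> the index \<open>n - 1\<close> is meaningless but carries the factor \<open>0\<close>.\<close>

lemma egf_array_rational_deriv:
  assumes "(1 + fps_const a * fps_X + fps_const b * fps_X ^ 2) * fps_deriv f = 1"
  shows "egf_array f (Suc n) (Suc m) = egf_array f n m - a * of_nat n * egf_array f n (Suc m)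
           - b * of_nat n * of_nat (n - 1) * egf_array f (n - 1) (Suc m)"
proof -
  define h where "h = fps_deriv f * f ^ m"
  have row: "fps_nth h k = egf_array f (Suc k) (Suc m) * fact m / fact k" for k
    by (simp add: h_def egf_array_Suc_Suc)
  have "h + fps_const a * (fps_X * h) + fps_const b * (fps_X * (fps_X * h))
      = (1 + fps_const a * fps_X + fps_const b * fps_X ^ 2) * fps_deriv f * f ^ m"
    by (simp add: h_def algebra_simps power2_eq_square)
  also have "\<dots> = f ^ m"
    by (simp add: assms)
  finally have "fps_nth (f ^ m) n = fps_nth h n + a * fps_nth (fps_X * h) n
      + b * fps_nth (fps_X * (fps_X * h)) n"
    by (metis fps_add_nth fps_mult_left_const_nth)
  then have "egf_array f n m = fact n / fact m * fps_nth h n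
      + a * (fact n / fact m * fps_nth (fps_X * h) n)
      + b * (fact n / fact m * fps_nth (fps_X * (fps_X * h)) n)"
    by (simp add: egf_array_def algebra_simps)
  moreover have "fact n / fact m * fps_nth h n = egf_array f (Suc n) (Suc m)"
    by (simp add: row)
  moreover have "fact n / fact m * fps_nth (fps_X * h) n = of_nat n * egf_array f n (Suc m)"
    by (cases n) (simp_all add: row)
  moreover have "fact n / fact m * fps_nth (fps_X * (fps_X * h)) n
      = of_nat n * of_nat (n - 1) * egf_array f (n - 1) (Suc m)"
  proof (cases n)
    case (Suc k)
    then show ?thesis by (cases k) (simp_all add: row)
  qed simp
  ultimately have "egf_array f n m = egf_array f (Suc n) (Suc m)
      + a * (of_nat n * egf_array f n (Suc m))
      + b * (of_nat n * of_nat (n - 1) * egf_array f (n - 1) (Suc m))"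
    by (simp only:)
  then show ?thesis
    by (simp add: algebra_simps)
qed

section \<open>The generating series\<close>

lemma fps_const_minus_1: "fps_const (- 1) = (- 1 :: 'a::comm_ring_1 fps)"
  by (metis fps_const_1_eq_1 fps_const_neg)

text \<open>The series \<open>u / (1 - c u)\<close>; the Lah numbers use \<open>c = 1\<close> and their signed version \<open>c = -1\<close>.\<close>

definition lah_series :: "real \<Rightarrow> real fps" where
  "lah_series c = fps_X * inverse (1 - fps_const c * fps_X)"

definition stir_S_series :: "real fps" where
  "stir_S_series = fps_const (1 / 2) * (fps_exp 2 - 1)"

definition stir_s_series :: "real fps" where
  "stir_s_series = fps_inv stir_S_series"

text \<open>Defined by composition, so that the relations between the series are immediate. That these
  are the hyperbolic tangent and its inverse enters only through the differential equations
  \<open>tanh_series_deriv\<close> and \<open>artanh_series_deriv\<close>.\<close>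

definition tanh_series :: "real fps" where
  "tanh_series = lah_series (-1) oo stir_S_series"

definition artanh_series :: "real fps" where
  "artanh_series = stir_s_series oo lah_series 1"

lemma series_nth_0 [simp]:
  "fps_nth (lah_series c) 0 = 0" "fps_nth stir_S_series 0 = 0" "fps_nth stir_s_series 0 = 0"
  "fps_nth tanh_series 0 = 0" "fps_nth artanh_series 0 = 0"
  by (simp_all add: lah_series_def stir_S_series_def stir_s_series_def tanh_series_def
      artanh_series_def fps_inv_def)

lemma lah_series_eq: "lah_series c * (1 - fps_const c * fps_X) = fps_X"
  by (simp add: lah_series_def mult.assoc inverse_mult_eq_1)

lemma lah_series_compose_eq:
  assumes "fps_nth g 0 = 0"
  shows "(lah_series c oo g) * (1 - fps_const c * g) = g"
proof -
  have "(lah_series c * (1 - fps_const c * fps_X)) oo g = g"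
    unfolding lah_series_eq using assms by simp
  then show ?thesis
    using assms by (simp add: fps_compose_mult_distrib fps_compose_sub_distrib)
qed

lemma lah_series_inverse: "lah_series 1 oo lah_series (-1) = fps_X"
proof -
  define f g where "f = lah_series 1 oo lah_series (-1)" and "g = lah_series (-1)"
  have "f * (1 - g) = g"
    using lah_series_compose_eq[of "lah_series (-1)" 1] by (simp add: f_def g_def)
  moreover have g: "g * (1 + fps_X) = fps_X"
    using lah_series_eq[of "-1"] by (simp add: g_def fps_const_minus_1)
  moreover from g have "(1 - g) * (1 + fps_X) = 1"
    by (simp add: algebra_simps)
  ultimately have "f = fps_X"
    by (metis mult.assoc mult.right_neutral)
  then show ?thesis by (simp add: f_def)
qed

lemma stir_S_series_deriv: "fps_deriv stir_S_series = 1 + fps_const 2 * stir_S_series"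
proof -
  have "fps_const 2 * stir_S_series = fps_exp 2 - 1"
    unfolding stir_S_series_def mult.assoc[symmetric] by simp
  moreover have "fps_deriv stir_S_series = fps_exp 2"
    unfolding stir_S_series_def by (simp add: mult.assoc[symmetric])
  ultimately show ?thesis by simp
qed

lemma stir_S_compose_stir_s: "stir_S_series oo stir_s_series = fps_X"
  unfolding stir_s_series_def by (rule fps_inv_right) (simp_all add: stir_S_series_def)

text \<open>Differentiating \<open>S \<circ> s = u\<close> and using \<open>S' = 1 + 2 S\<close>: this is \<open>s = ln (1 + 2 u) / 2\<close>.\<close>

lemma stir_s_series_deriv: "(1 + fps_const 2 * fps_X) * fps_deriv stir_s_series = 1"
proof -
  have "1 = fps_deriv (stir_S_series oo stir_s_series)"
    by (simp add: stir_S_compose_stir_s)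
  also have "\<dots> = ((1 + fps_const 2 * stir_S_series) oo stir_s_series) * fps_deriv stir_s_series"
    by (simp add: fps_compose_deriv stir_S_series_deriv)
  also have "(1 + fps_const 2 * stir_S_series) oo stir_s_series = 1 + fps_const 2 * fps_X"
    by (simp add: fps_compose_add_distrib fps_compose_mult_distrib stir_S_compose_stir_s)
  finally show ?thesis by simp
qed

text \<open>Differentiate \<open>t (1 + S) = S\<close>; the factor \<open>S' = 1 + 2 S\<close> equals \<open>(1 + t) (1 + S)\<close>, and
  \<open>1 + S\<close> cancels.\<close>

lemma tanh_series_deriv: "fps_deriv tanh_series = 1 - tanh_series ^ 2"
proof -
  define S t where "S = stir_S_series" and "t = tanh_series"
  have eq: "t * (1 + S) = S"
    using lah_series_compose_eq[of S "-1"] by (simp add: S_def t_def tanh_series_def fps_const_minus_1)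
  have S': "fps_deriv S = 1 + 2 * S"
    using stir_S_series_deriv by (simp add: S_def numeral_fps_const)
  have "fps_deriv (t * (1 + S)) = fps_deriv S"
    by (simp add: eq)
  then have "fps_deriv t * (1 + S) + t * (1 + 2 * S) = 1 + 2 * S"
    by (simp add: S' algebra_simps)
  then have "fps_deriv t * (1 + S) = (1 - t) * (1 + 2 * S)"
    by (simp add: left_diff_distrib eq_diff_eq)
  also have "1 + 2 * S = (1 + S) + t * (1 + S)"
    by (simp add: eq)
  also have "(1 - t) * ((1 + S) + t * (1 + S)) = (1 - t ^ 2) * (1 + S)"
    by (simp add: algebra_simps power2_eq_square)
  finally have "fps_deriv t * (1 + S) = (1 - t ^ 2) * (1 + S)" .
  moreover have "1 + S \<noteq> 0"
  proof
    assume "1 + S = 0"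
    then have "fps_nth (1 + S) 0 = 0" by simp
    then show False by (simp add: S_def)
  qed
  ultimately show ?thesis by (simp add: t_def)
qed

text \<open>By the chain rule the derivative is \<open>q l'\<close> with \<open>q = s' \<circ> l = 1 / (1 + 2 l)\<close>, and
  \<open>1 + 2 l = (1 + u) / (1 - u)\<close>, \<open>l' = 1 / (1 - u)\<^sup>2\<close>.\<close>

lemma artanh_series_deriv: "(1 - fps_X ^ 2) * fps_deriv artanh_series = 1"
proof -
  define l where "l = lah_series 1"
  define q where "q = fps_deriv stir_s_series oo l"
  have l0: "fps_nth l 0 = 0" by (simp add: l_def)
  have l: "l * (1 - fps_X) = fps_X"
    using lah_series_eq[of 1] by (simp add: l_def)
  have "fps_deriv (l * (1 - fps_X)) = 1"
    by (simp add: l)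
  then have l': "fps_deriv l * (1 - fps_X) = 1 + l"
    by (simp add: algebra_simps)
  have "((1 + fps_const 2 * fps_X) * fps_deriv stir_s_series) oo l = 1"
    by (simp add: stir_s_series_deriv)
  then have q: "(1 + 2 * l) * q = 1"
    using l0 by (simp add: q_def fps_compose_mult_distrib fps_compose_add_distrib
        numeral_fps_const)
  have "fps_deriv artanh_series = q * fps_deriv l"
    using l0 by (simp add: artanh_series_def q_def l_def[symmetric] fps_compose_deriv)
  moreover have "1 - fps_X ^ 2 = (1 - fps_X) * ((1 - fps_X) * (1 + 2 * l))"
  proof -
    have "(1 - fps_X) * (1 + 2 * l) = 1 - fps_X + 2 * (l * (1 - fps_X))"
      by (simp add: algebra_simps)
    also have "\<dots> = 1 + fps_X"
      unfolding l by simp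
    finally have "(1 - fps_X) * (1 + 2 * l) = 1 + fps_X" .
    then show ?thesis
      by (simp only:) (simp add: algebra_simps power2_eq_square)
  qed
  ultimately have "(1 - fps_X ^ 2) * fps_deriv artanh_series
      = (fps_deriv l * (1 - fps_X)) * (1 - fps_X) * ((1 + 2 * l) * q)"
    by (simp only: mult_ac)
  also have "\<dots> = 1 - fps_X + l * (1 - fps_X)"
    unfolding l' q by (simp add: algebra_simps)
  also have "\<dots> = 1"
    unfolding l by simp
  finally show ?thesis .
qed

section \<open>The six arrays as exponential arrays\<close>

text \<open>The identity \<open>(1 - c u) f\<^sup>m\<^sup>+\<^sup>1 = u f\<^sup>m\<close> is Pascal's rule for the coefficients.\<close>

lemma lah_series_power_nth:
  "fps_nth (lah_series c ^ Suc m) (Suc n) = c ^ (n - m) * real (n choose m)"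
proof (induction n arbitrary: m)
  have rec: "fps_nth (lah_series c ^ Suc m) (Suc n)
      = fps_nth (lah_series c ^ m) n + c * fps_nth (lah_series c ^ Suc m) n" for n m
  proof -
    have "lah_series c ^ Suc m * (1 - fps_const c * fps_X) = fps_X * lah_series c ^ m"
      using lah_series_eq[of c] by (simp add: mult_ac)
    then have "lah_series c ^ Suc m
        = fps_X * lah_series c ^ m + fps_const c * (fps_X * lah_series c ^ Suc m)"
      by (simp add: algebra_simps)
    then have "fps_nth (lah_series c ^ Suc m) (Suc n)
        = fps_nth (fps_X * lah_series c ^ m + fps_const c * (fps_X * lah_series c ^ Suc m)) (Suc n)"
      by (rule arg_cong)
    then show ?thesis by simp
  qed
  {
    case 0
    show ?case using rec[of m 0] by (cases m) simp_all
  next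
    case (Suc n)
    show ?case
    proof (cases m)
      case 0
      with rec[of 0 "Suc n"] Suc[of 0] show ?thesis by simp
    next
      case (Suc k)
      \<comment> \<open>Truncated subtraction does no harm: \<open>n choose Suc k = 0\<close> for \<open>n \<le> k\<close>.\<close>
      have "c * (c ^ (n - Suc k) * real (n choose Suc k)) = c ^ (n - k) * real (n choose Suc k)"
      proof (cases "k < n")
        case True
        then have "n - k = Suc (n - Suc k)" by simp
        then show ?thesis by simp
      qed simp
      with rec[of "Suc k" "Suc n"] Suc.IH[of k] Suc.IH[of "Suc k"] Suc show ?thesis
        by (simp add: algebra_simps del: power_Suc)
    qed
  }
qed

lemma lah_l_eq: "lah_l n m = egf_array (lah_series 1) n m"
proof (cases n; cases m)
  fix n' m' assume "n = Suc n'" "m = Suc m'"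
  then show ?thesis
    by (simp add: lah_l_def egf_array_def lah_series_power_nth del: power_Suc)
qed (simp_all add: lah_l_def egf_array_0_left egf_array_Suc_0)

lemma lah_L_eq: "lah_L n m = egf_array (lah_series (-1)) n m"
proof (cases n; cases m)
  fix n' m' assume nm: "n = Suc n'" "m = Suc m'"
  show ?thesis
  proof (cases "m' \<le> n'")
    case True
    then have "int n - int m = int (n' - m')" using nm by (simp add: of_nat_diff)
    then have "(-1::real) powi (int n - int m) = (-1) ^ (n' - m')"
      by (simp only: power_int_of_nat)
    then show ?thesis
      unfolding lah_L_def lah_l_def egf_array_def
      by (simp only: nm lah_series_power_nth) simp
  next
    case False
    then show ?thesis using nm
      by (simp add: lah_L_def lah_l_def egf_array_def lah_series_power_nth del: power_Suc)
  qed
qed (simp_all add: lah_L_def lah_l_def egf_array_0_left egf_array_Suc_0)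

lemma stir_S_eq: "stir_S n m = egf_array stir_S_series n m"
proof (induction n arbitrary: m)
  case 0
  show ?case by (cases m) (simp_all add: stir_S_def egf_array_0_left)
next
  case (Suc n)
  show ?case
  proof (cases m)
    case 0
    then show ?thesis by (simp add: stir_S_def egf_array_Suc_0)
  next
    case m: (Suc k)
    have "(2::real) powi (int n - int k) = 2 * 2 powi (int n - int (Suc k))"
      using power_int_add_1'[of "2::real" "int n - int (Suc k)"] by simp
    then have "stir_S (Suc n) (Suc k) = stir_S n k + 2 * real (Suc k) * stir_S n (Suc k)"
      by (simp add: stir_S_def algebra_simps)
    also have "\<dots> = egf_array stir_S_series (Suc n) (Suc k)"
      using egf_array_riccati[of stir_S_series 2 0 n k] stir_S_series_deriv
      by (simp add: Suc.IH)
    finally show ?thesis using m by simp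
  qed
qed

lemma stir_s_eq: "stir_s n m = egf_array stir_s_series n m"
proof (induction n arbitrary: m)
  case 0
  show ?case by (cases m) (simp_all add: stir_s_def egf_array_0_left)
next
  case (Suc n)
  show ?case
  proof (cases m)
    case 0
    then show ?thesis by (simp add: stir_s_def egf_array_Suc_0)
  next
    case m: (Suc k)
    have "(-2::real) powi (int n - int k) = -2 * (-2) powi (int n - int (Suc k))"
      using power_int_add_1'[of "-2::real" "int n - int (Suc k)"] by simp
    then have "stir_s (Suc n) (Suc k) = stir_s n k - 2 * real n * stir_s n (Suc k)"
      by (simp add: stir_s_def algebra_simps)
    also have "\<dots> = egf_array stir_s_series (Suc n) (Suc k)"
      using egf_array_rational_deriv[of 2 0 stir_s_series n k] stir_s_series_deriv
      by (simp add: Suc.IH)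
    finally show ?thesis using m by simp
  qed
qed

lemma tan_T_eq: "tan_T n m = egf_array (fps_tan 1) n m"
  by (simp add: tan_T_def egf_array_def)

lemma arctan_t_eq: "arctan_t n m = egf_array fps_arctan n m"
  by (simp add: arctan_t_def egf_array_def)

lemma fps_tan_nth_0: "fps_nth (fps_tan c) 0 = 0"
  by (simp add: fps_tan_def)

lemma fps_arctan_nth_0: "fps_nth fps_arctan 0 = 0"
  by (simp add: fps_arctan_def)

lemma fps_tan_deriv_riccati:
  "fps_deriv (fps_tan (1::real)) = 1 + fps_tan 1 ^ 2"
proof -
  define c s where "c = fps_cos (1::real)" and "s = fps_sin (1::real)"
  have c0: "fps_nth (c ^ 2) 0 \<noteq> 0" "fps_nth c 0 \<noteq> 0" by (simp_all add: c_def fps_nth_power_0)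
  have t: "fps_tan 1 * c = s"
    unfolding fps_tan_def using c0(2)
    by (simp add: c_def s_def fps_divide_unit mult.assoc inverse_mult_eq_1)
  have "fps_deriv (fps_tan 1) * c ^ 2 = 1"
    unfolding fps_tan_deriv using c0(1)
    by (simp add: c_def[symmetric] fps_divide_unit inverse_mult_eq_1)
  also have "1 = c ^ 2 + s ^ 2"
    unfolding c_def s_def by (rule fps_sin_cos_sum_of_squares[symmetric])
  also have "\<dots> = (1 + fps_tan 1 ^ 2) * c ^ 2"
    unfolding t[symmetric] by (simp add: algebra_simps power2_eq_square)
  finally show ?thesis using c0 by auto
qed

lemma fps_arctan_deriv: "(1 + fps_X ^ 2) * fps_deriv fps_arctan = 1"
proof (rule fps_ext)
  fix n
  have d: "fps_nth (fps_deriv fps_arctan) k = (if even k then (-1) ^ (k div 2) else 0)" for k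
    by (simp add: fps_arctan_def del: of_nat_Suc of_nat_add)
  show "fps_nth ((1 + fps_X ^ 2) * fps_deriv fps_arctan) n = fps_nth 1 n"
  proof (cases "n < 2")
    case True
    then have "n = 0 \<or> n = 1" by auto
    then show ?thesis
      by (auto simp add: distrib_right fps_X_power_mult_nth d simp del: fps_deriv_nth)
  next
    case False
    then obtain k where "n = Suc (Suc k)" by (metis add_2_eq_Suc le_Suc_ex not_less)
    then show ?thesis
      by (simp add: distrib_right fps_X_power_mult_nth d del: fps_deriv_nth)
  qed
qed

text \<open>Passing from the column \<open>m\<close> to \<open>m + 2\<close> flips the sign \<open>(-1)^((n-m)/2)\<close>, so the coefficient of
  \<open>f\<^sup>2\<close> in the equation for \<open>tan\<close> is negated and the equation for \<open>tanh\<close> appears.\<close>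

lemma tanh_Theta_eq: "tanh_Theta n m = egf_array tanh_series n m"
proof (induction n arbitrary: m)
  case 0
  show ?case
    by (simp add: tanh_Theta_def tan_T_eq egf_array_0_left fps_tan_nth_0)
next
  case (Suc n)
  show ?case
  proof (cases m)
    case 0
    then show ?thesis by (simp add: tanh_Theta_def tan_T_eq egf_array_Suc_0)
  next
    case m: (Suc k)
    have T: "tan_T (Suc n) (Suc k)
        = tan_T n k + real (Suc k) * real (Suc (Suc k)) * tan_T n (Suc (Suc k))"
      using egf_array_riccati[of "fps_tan 1" 0 1 n k] fps_tan_deriv_riccati
      by (simp add: tan_T_eq)
    have sign: "(-1::real) powi ((int n - int (Suc (Suc k))) div 2)
        = - ((-1) powi ((int n - int k) div 2))"
    proof -
      have "(int n - int k) div 2 = (int n - int (Suc (Suc k))) div 2 + 1" by simp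
      then show ?thesis by (simp only:) (simp add: power_int_add_1)
    qed
    have "tanh_Theta (Suc n) (Suc k)
        = tanh_Theta n k - real (Suc k) * real (Suc (Suc k)) * tanh_Theta n (Suc (Suc k))"
    proof (cases "even (int n - int k)")
      case True
      then have "even (int n - int (Suc (Suc k)))" by simp
      with True show ?thesis
        unfolding tanh_Theta_def T sign by (simp add: algebra_simps)
    next
      case False
      then have "odd (int n - int (Suc (Suc k)))" by simp
      with False show ?thesis
        unfolding tanh_Theta_def by simp
    qed
    also have "\<dots> = egf_array tanh_series (Suc n) (Suc k)"
      using egf_array_riccati[of tanh_series 0 "-1" n k] tanh_series_deriv
      by (simp add: Suc.IH fps_const_minus_1 del: of_nat_Suc)
    finally show ?thesis using m by simp
  qed
qed

text \<open>Same sign change, now between the rows \<open>n + 1\<close> and \<open>n - 1\<close>. The recurrence reaches two rows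
  back, hence complete induction.\<close>

lemma tanh_theta_eq: "tanh_theta n m = egf_array artanh_series n m"
proof (induction n arbitrary: m rule: less_induct)
  case (less n)
  show ?case
  proof (cases n)
    case 0
    then show ?thesis
      by (simp add: tanh_theta_def arctan_t_eq egf_array_0_left fps_arctan_nth_0)
  next
    case n: (Suc p)
    show ?thesis
    proof (cases m)
      case 0
      then show ?thesis using n by (simp add: tanh_theta_def arctan_t_eq egf_array_Suc_0)
    next
      case m: (Suc k)
      have t: "arctan_t (Suc p) (Suc k)
          = arctan_t p k - real p * real (p - 1) * arctan_t (p - 1) (Suc k)"
        using egf_array_rational_deriv[of 0 1 fps_arctan p k] fps_arctan_deriv
        by (simp add: arctan_t_eq)
      have "tanh_theta (Suc p) (Suc k)
          = tanh_theta p k + real p * real (p - 1) * tanh_theta (p - 1) (Suc k)"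
      proof (cases p)
        case 0
        then show ?thesis using t by (simp add: tanh_theta_def)
      next
        case (Suc j)
        have sign: "(-1::real) powi ((int (Suc j) - int k) div 2)
            = - ((-1) powi ((int j - int (Suc k)) div 2))"
        proof -
          have "(int (Suc j) - int k) div 2 = (int j - int (Suc k)) div 2 + 1" by simp
          then show ?thesis by (simp only:) (simp add: power_int_add_1)
        qed
        have d: "int (Suc (Suc j)) - int (Suc k) = int (Suc j) - int k" by simp
        show ?thesis
        proof (cases "even (int (Suc j) - int k)")
          case True
          then have "even (int j - int (Suc k))" by auto
          with True show ?thesis
            unfolding tanh_theta_def Suc d t[unfolded Suc] sign by (simp add: algebra_simps)
        next
          case False
          then have "odd (int j - int (Suc k))" by auto
          with False Suc show ?thesis
            unfolding tanh_theta_def Suc d by simp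
        qed
      qed
      also have "\<dots> = egf_array artanh_series (Suc p) (Suc k)"
        using egf_array_rational_deriv[of 0 "-1" artanh_series p k] artanh_series_deriv
          less.IH[of p k] less.IH[of "p - 1" "Suc k"] n
        by (simp add: fps_const_minus_1)
      finally show ?thesis using n m by simp
    qed
  qed
qed

section \<open>Conversion between the arrays\<close>

theorem theorem2p1:
  fixes n m :: nat
  shows
   "(tanh_Theta n m = (\<Sum>i\<le>n. lah_L i m * stir_S n i)
      \<and> stir_S n m = (\<Sum>i\<le>n. lah_l i m * tanh_Theta n i)
      \<and> tanh_theta n m = (\<Sum>i\<le>n. lah_l n i * stir_s i m)
      \<and> stir_s n m = (\<Sum>i\<le>n. lah_L n i * tanh_theta i m))
  \<and> (lah_L n m = (\<Sum>i\<le>n. stir_s n i * tanh_Theta i m)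
      \<and> tanh_Theta n m = (\<Sum>i\<le>n. stir_S n i * lah_L i m)
      \<and> lah_l n m = (\<Sum>i\<le>n. stir_S i m * tanh_theta n i)
      \<and> tanh_theta n m = (\<Sum>i\<le>n. stir_s i m * lah_l n i))
  \<and> (lah_l n m = (\<Sum>i\<le>n. tanh_theta n i * stir_S i m)
      \<and> stir_S n m = (\<Sum>i\<le>n. tanh_Theta n i * lah_l i m)
      \<and> lah_L n m = (\<Sum>i\<le>n. tanh_Theta i m * stir_s n i)
      \<and> stir_s n m = (\<Sum>i\<le>n. tanh_theta i m * lah_L n i))"
proof -
  have S_tanh: "lah_series 1 oo tanh_series = stir_S_series"
    by (simp add: tanh_series_def fps_compose_assoc lah_series_inverse)
  have s_artanh: "artanh_series oo lah_series (-1) = stir_s_series"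
    by (simp add: artanh_series_def fps_compose_assoc[symmetric] lah_series_inverse)
  have L_tanh: "tanh_series oo stir_s_series = lah_series (-1)"
    by (simp add: tanh_series_def fps_compose_assoc[symmetric] stir_S_compose_stir_s)
  have l_artanh: "stir_S_series oo artanh_series = lah_series 1"
    by (simp add: artanh_series_def fps_compose_assoc stir_S_compose_stir_s)
  have Theta: "tanh_Theta n m = (\<Sum>i\<le>n. stir_S n i * lah_L i m)"
    by (simp add: tanh_Theta_eq stir_S_eq lah_L_eq sum_egf_array tanh_series_def)
  have theta: "tanh_theta n m = (\<Sum>i\<le>n. lah_l n i * stir_s i m)"
    by (simp add: tanh_theta_eq stir_s_eq lah_l_eq sum_egf_array artanh_series_def)
  have S: "stir_S n m = (\<Sum>i\<le>n. tanh_Theta n i * lah_l i m)"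
    by (simp add: tanh_Theta_eq stir_S_eq lah_l_eq sum_egf_array S_tanh)
  have s: "stir_s n m = (\<Sum>i\<le>n. lah_L n i * tanh_theta i m)"
    by (simp add: tanh_theta_eq stir_s_eq lah_L_eq sum_egf_array s_artanh)
  have L: "lah_L n m = (\<Sum>i\<le>n. stir_s n i * tanh_Theta i m)"
    by (simp add: tanh_Theta_eq stir_s_eq lah_L_eq sum_egf_array L_tanh)
  have l: "lah_l n m = (\<Sum>i\<le>n. tanh_theta n i * stir_S i m)"
    by (simp add: tanh_theta_eq stir_S_eq lah_l_eq sum_egf_array l_artanh)
  show ?thesis
    using Theta theta S s L l
    by (intro conjI) (simp_all only: mult.commute)
qed

end
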